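(* Let $g\colon\{0,1\}^n\to\{0,1\}$ be any function. Then $f(x,y)=g(x\vee y)$ (for $x,y\in\{0,1\}^n$) admits a 2-party BSM protocol of size $O(2^{0.729n})$.
   Context: $x\vee y$ denotes bitwise OR. A 2-party BSM protocol of size $s$ for $f\colon\{0,1\}^n\times\{0,1\}^n\to\{0,1\}$ consists of arbitrary functions $A$ (Alice) and $B$ (Bob) mapping $\{0,1\}^n$ to bit strings and a Boolean circuit $C$ (Carol) of size $s$ such that $f(x,y)=C(A(x),B(y))$ for all $x,y$. *)

theory Defs
  imports Complex_Main "HOL-Library.FuncSet" "HOL-Library.Landau_Symbols"
begin

definition bitvecs :: "nat \<Rightarrow> bool list set" where
  "bitvecs n = {x. length x = n}"

definition bitwise_or :: "bool list \<Rightarrow> bool list \<Rightarrow> bool list" (infixl \<open>\<or>\<^sub>b\<close> 65) where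
  "x \<or>\<^sub>b y = map2 (\<or>) x y"

text \<open>Boolean circuits over AND, OR (fan-in two) and NOT, as straight-line programs.
  Wires \<open>0, \<dots>, m - 1\<close> carry the \<open>m\<close> inputs, and wire \<open>m + i\<close> carries the output of
  the \<open>i\<close>-th gate; arguments of gates are wire numbers. Wires may be reused, so fan-out is
  unbounded, and the output may be taken from any wire.\<close>

datatype gate = And nat nat | Or nat nat | Not nat

datatype circuit = Circuit (gates: "gate list") (out_wire: nat)

fun gate_wires :: "gate \<Rightarrow> nat set" where
  "gate_wires (And i j) = {i, j}"
| "gate_wires (Or i j) = {i, j}"
| "gate_wires (Not i) = {i}"

fun gate_value :: "bool list \<Rightarrow> gate \<Rightarrow> bool" where
  "gate_value ws (And i j) = (ws ! i \<and> ws ! j)"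
| "gate_value ws (Or i j) = (ws ! i \<or> ws ! j)"
| "gate_value ws (Not i) = (\<not> ws ! i)"

definition wf_circuit :: "nat \<Rightarrow> circuit \<Rightarrow> bool" where
  "wf_circuit m C \<longleftrightarrow>
     (\<forall>i < length (gates C). \<forall>w \<in> gate_wires (gates C ! i). w < m + i) \<and>
     out_wire C < m + length (gates C)"

definition wire_values :: "gate list \<Rightarrow> bool list \<Rightarrow> bool list" where
  "wire_values gs inp = foldl (\<lambda>ws g. ws @ [gate_value ws g]) inp gs"

definition circuit_value :: "circuit \<Rightarrow> bool list \<Rightarrow> bool" where
  "circuit_value C inp = wire_values (gates C) inp ! out_wire C"

definition circuit_size :: "circuit \<Rightarrow> nat" where
  "circuit_size C = length (gates C)"

text \<open>The messages of Alice and Bob have fixed lengths \<open>a\<close> and \<open>b\<close>, so that Carol's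
  circuit has \<open>a + b\<close> inputs.\<close>

definition is_BSM_protocol ::
  "nat \<Rightarrow> (bool list \<Rightarrow> bool list \<Rightarrow> bool) \<Rightarrow> nat \<Rightarrow> nat \<Rightarrow>
   (bool list \<Rightarrow> bool list) \<Rightarrow> (bool list \<Rightarrow> bool list) \<Rightarrow> circuit \<Rightarrow> bool" where
  "is_BSM_protocol n f a b A B C \<longleftrightarrow>
     A \<in> bitvecs n \<rightarrow> bitvecs a \<and> B \<in> bitvecs n \<rightarrow> bitvecs b \<and> wf_circuit (a + b) C \<and>
     (\<forall>x \<in> bitvecs n. \<forall>y \<in> bitvecs n. f x y = circuit_value C (A x @ B y))"

definition admits_BSM_protocol ::
  "nat \<Rightarrow> (bool list \<Rightarrow> bool list \<Rightarrow> bool) \<Rightarrow> nat \<Rightarrow> bool" where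
  "admits_BSM_protocol n f s \<longleftrightarrow>
     (\<exists>a b A B C. is_BSM_protocol n f a b A B C \<and> circuit_size C = s)"

end

theory Submission
  imports Defs "HOL-Real_Asymp.Real_Asymp"
begin

text \<open>If \<open>\<bar>y\<bar> \<le> \<bar>x\<bar>\<close>, then \<open>z = x \<or> y\<close> is one of the vectors above \<open>x\<close> of Hamming weight at
  most \<open>2\<bar>x\<bar>\<close>. Weighting \<open>z\<close> by \<open>q\<close> to the power \<open>\<bar>z\<bar> - 2\<bar>x\<bar>\<close> with \<open>q < 1\<close> shows that there are at most
  \<open>(1/q)^\<bar>x\<bar> (1 + q)^(n - \<bar>x\<bar>)\<close> of these; this is \<open>\<phi>^n = 2^(0.694\<dots>n)\<close> for the inverse \<open>q\<close> of
  the golden ratio \<open>\<phi>\<close>. For each such \<open>z\<close> with \<open>g z = 1\<close> Alice sends a subcube that contains \<open>y\<close> iff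
  \<open>x \<or> y = z\<close>; Carol tests membership in each of them with \<open>O(n)\<close> gates. Bob does the same for
  \<open>y\<close>. No test ever succeeds wrongly, and the heavier party's list suffices, so Carol outputs the
  disjunction of all tests.\<close>

section \<open>Circuits of the form OR of ANDs of pairs\<close>

lemma wire_values_snoc:
  "wire_values (gs @ [g]) inp = wire_values gs inp @ [gate_value (wire_values gs inp) g]"
  by (simp add: wire_values_def)

lemma length_wire_values [simp]: "length (wire_values gs inp) = length inp + length gs"
proof (induction gs rule: rev_induct)
  case Nil
  then show ?case by (simp add: wire_values_def)
next
  case (snoc g gs)
  then show ?case by (simp add: wire_values_snoc)
qed

lemma nth_wire_values_append:
  assumes "w < length inp + length gs"
  shows "wire_values (gs @ hs) inp ! w = wire_values gs inp ! w"
proof (induction hs rule: rev_induct)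
  case Nil
  then show ?case by simp
next
  case (snoc h hs)
  then show ?case using assms wire_values_snoc[of "gs @ hs" h inp]
    by (simp add: nth_append)
qed

text \<open>The gate condition of \<open>wf_circuit\<close> without an output wire, as unfinished
  gate lists are still to be extended.\<close>

definition straight_line :: "nat \<Rightarrow> gate list \<Rightarrow> bool" where
  "straight_line m gs \<longleftrightarrow> (\<forall>i < length gs. \<forall>w \<in> gate_wires (gs ! i). w < m + i)"

definition computes :: "nat \<Rightarrow> gate list \<Rightarrow> (bool list \<Rightarrow> bool) \<Rightarrow> bool" where
  "computes m gs \<phi> \<longleftrightarrow>
     (\<exists>w < m + length gs. \<forall>inp \<in> bitvecs m. wire_values gs inp ! w = \<phi> inp)"

text \<open>Quantifying over the gates already present makes the costs of subformulas add up.\<close>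

definition extension_cost :: "nat \<Rightarrow> nat \<Rightarrow> (bool list \<Rightarrow> bool) \<Rightarrow> bool" where
  "extension_cost m c \<phi> \<longleftrightarrow> (\<forall>gs. straight_line m gs \<longrightarrow>
     (\<exists>hs. length hs \<le> c \<and> straight_line m (gs @ hs) \<and> computes m (gs @ hs) \<phi>))"

lemma straight_line_snoc:
  "straight_line m gs \<Longrightarrow> \<forall>w \<in> gate_wires g. w < m + length gs \<Longrightarrow> straight_line m (gs @ [g])"
  by (auto simp: straight_line_def nth_append less_Suc_eq)

lemma computes_append:
  assumes "computes m gs \<phi>"
  shows "computes m (gs @ hs) \<phi>"
proof -
  obtain w where w: "w < m + length gs"
      "\<And>inp. inp \<in> bitvecs m \<Longrightarrow> wire_values gs inp ! w = \<phi> inp"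
    using assms unfolding computes_def by blast
  then have "wire_values (gs @ hs) inp ! w = \<phi> inp" if "inp \<in> bitvecs m" for inp
    using that by (simp add: nth_wire_values_append bitvecs_def)
  then show ?thesis
    using w(1) unfolding computes_def by (intro exI[of _ w]) simp
qed

lemma computes_snoc:
  assumes "\<And>inp. inp \<in> bitvecs m \<Longrightarrow> gate_value (wire_values gs inp) g = \<phi> inp"
  shows "computes m (gs @ [g]) \<phi>"
  unfolding computes_def
  by (rule exI[of _ "m + length gs"])
    (use assms in \<open>auto simp: wire_values_snoc nth_append bitvecs_def\<close>)

lemma extension_costE:
  assumes "extension_cost m c \<phi>" "straight_line m gs"
  obtains hs where "length hs \<le> c" "straight_line m (gs @ hs)" "computes m (gs @ hs) \<phi>"
  using assms unfolding extension_cost_def by blast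

section \<open>Gate costs of formulas\<close>

lemma extension_cost_input: "i < m \<Longrightarrow> extension_cost m 0 (\<lambda>inp. inp ! i)"
  unfolding extension_cost_def computes_def
proof (intro allI impI)
  fix gs assume i: "i < m" and gs: "straight_line m gs"
  have "wire_values gs inp ! i = inp ! i" if "inp \<in> bitvecs m" for inp
    using nth_wire_values_append[of i inp "[]" gs] that i
    by (simp add: bitvecs_def wire_values_def)
  then show "\<exists>hs. length hs \<le> 0 \<and> straight_line m (gs @ hs) \<and>
    (\<exists>w<m + length (gs @ hs). \<forall>inp\<in>bitvecs m. wire_values (gs @ hs) inp ! w = inp ! i)"
    using i gs by (intro exI[of _ "[]"]) (auto intro!: exI[of _ i])
qed

lemma extension_cost_Not:
  assumes "extension_cost m c \<phi>"
  shows "extension_cost m (c + 1) (\<lambda>inp. \<not> \<phi> inp)"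
  unfolding extension_cost_def
proof (intro allI impI)
  fix gs assume "straight_line m gs"
  with assms obtain hs where hs: "length hs \<le> c" "straight_line m (gs @ hs)" "computes m (gs @ hs) \<phi>"
    by (rule extension_costE)
  then obtain w where w: "w < m + length (gs @ hs)"
      "\<And>inp. inp \<in> bitvecs m \<Longrightarrow> wire_values (gs @ hs) inp ! w = \<phi> inp"
    unfolding computes_def by blast
  have "straight_line m ((gs @ hs) @ [Not w])"
    by (rule straight_line_snoc) (use hs w in auto)
  moreover have "computes m ((gs @ hs) @ [Not w]) (\<lambda>inp. \<not> \<phi> inp)"
    by (rule computes_snoc) (use w in auto)
  ultimately show "\<exists>hs. length hs \<le> c + 1 \<and> straight_line m (gs @ hs) \<and>
      computes m (gs @ hs) (\<lambda>inp. \<not> \<phi> inp)"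
    using hs(1) by (intro exI[of _ "hs @ [Not w]"]) simp
qed

text \<open>The gates for \<open>\<psi>\<close> are placed after those for \<open>\<phi>\<close>,
  whose wire keeps its value under extension; one last gate joins the two wires.\<close>

lemma extension_cost_binary:
  assumes "extension_cost m c \<phi>" "extension_cost m d \<psi>"
    and wires: "\<And>i j. gate_wires (G i j) = {i, j}"
    and val: "\<And>ws i j. gate_value ws (G i j) = F (ws ! i) (ws ! j)"
  shows "extension_cost m (c + d + 1) (\<lambda>inp. F (\<phi> inp) (\<psi> inp))"
  unfolding extension_cost_def
proof (intro allI impI)
  fix gs assume "straight_line m gs"
  with assms(1) obtain hs where hs: "length hs \<le> c" "straight_line m (gs @ hs)" "computes m (gs @ hs) \<phi>"
    by (rule extension_costE)
  from assms(2) hs(2) obtain ks where ks: "length ks \<le> d"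
      "straight_line m ((gs @ hs) @ ks)" "computes m ((gs @ hs) @ ks) \<psi>"
    by (rule extension_costE)
  let ?gs = "(gs @ hs) @ ks"
  obtain v w where v: "v < m + length ?gs"
      "\<And>inp. inp \<in> bitvecs m \<Longrightarrow> wire_values ?gs inp ! v = \<phi> inp"
    and w: "w < m + length ?gs"
      "\<And>inp. inp \<in> bitvecs m \<Longrightarrow> wire_values ?gs inp ! w = \<psi> inp"
    using ks(3) computes_append[OF hs(3), of ks] unfolding computes_def by blast
  have "straight_line m (?gs @ [G v w])"
    by (rule straight_line_snoc) (use ks v w wires in auto)
  moreover have "computes m (?gs @ [G v w]) (\<lambda>inp. F (\<phi> inp) (\<psi> inp))"
    by (rule computes_snoc) (use v w val in auto)
  ultimately show "\<exists>hs. length hs \<le> c + d + 1 \<and> straight_line m (gs @ hs) \<and>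
      computes m (gs @ hs) (\<lambda>inp. F (\<phi> inp) (\<psi> inp))"
    using hs(1) ks(1) by (intro exI[of _ "hs @ ks @ [G v w]"]) simp
qed

lemma extension_cost_And:
  assumes "extension_cost m c \<phi>" "extension_cost m d \<psi>"
  shows "extension_cost m (c + d + 1) (\<lambda>inp. \<phi> inp \<and> \<psi> inp)"
  using assms by (rule extension_cost_binary[where G = And and F = "(\<and>)"]) simp_all

lemma extension_cost_Or:
  assumes "extension_cost m c \<phi>" "extension_cost m d \<psi>"
  shows "extension_cost m (c + d + 1) (\<lambda>inp. \<phi> inp \<or> \<psi> inp)"
  using assms by (rule extension_cost_binary[where G = Or and F = "(\<or>)"]) simp_all

text \<open>There are no constant gates, so a constant is computed from input wire 0 and its
  negation.\<close>

lemma extension_cost_True: "0 < m \<Longrightarrow> extension_cost m 2 (\<lambda>_. True)"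
  using extension_cost_Or[OF extension_cost_input extension_cost_Not[OF extension_cost_input], of 0 m 0]
  by (simp add: numeral_2_eq_2)

lemma extension_cost_False: "0 < m \<Longrightarrow> extension_cost m 2 (\<lambda>_. False)"
  using extension_cost_And[OF extension_cost_input extension_cost_Not[OF extension_cost_input], of 0 m 0]
  by (simp add: numeral_2_eq_2)

lemma extension_cost_Ball:
  assumes "0 < m" "\<And>j. j \<in> set js \<Longrightarrow> extension_cost m c (\<phi> j)"
  shows "extension_cost m (length js * (c + 1) + 2) (\<lambda>inp. \<forall>j \<in> set js. \<phi> j inp)"
  using assms(2)
proof (induction js)
  case Nil
  then show ?case using extension_cost_True[OF assms(1)] by (simp add: numeral_2_eq_2)
next
  case (Cons j js)
  then show ?case
    using extension_cost_And[OF Cons.prems[of j] Cons.IH] by (simp add: algebra_simps)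
qed

lemma extension_cost_Bex:
  assumes "0 < m" "\<And>t. t \<in> set ts \<Longrightarrow> extension_cost m c (\<phi> t)"
  shows "extension_cost m (length ts * (c + 1) + 2) (\<lambda>inp. \<exists>t \<in> set ts. \<phi> t inp)"
  using assms(2)
proof (induction ts)
  case Nil
  then show ?case using extension_cost_False[OF assms(1)] by (simp add: numeral_2_eq_2)
next
  case (Cons t ts)
  then show ?case
    using extension_cost_Or[OF Cons.prems[of t] Cons.IH] by (simp add: algebra_simps)
qed

lemma extension_cost_imp_circuit:
  assumes "extension_cost m c \<phi>"
  obtains C where "wf_circuit m C" "circuit_size C \<le> c"
    "\<And>inp. inp \<in> bitvecs m \<Longrightarrow> circuit_value C inp = \<phi> inp"
proof -
  have "straight_line m []" by (simp add: straight_line_def)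
  with assms obtain gs where gs: "length gs \<le> c" "straight_line m gs" "computes m gs \<phi>"
    by (metis extension_costE append_Nil)
  then obtain w where "w < m + length gs"
      "\<And>inp. inp \<in> bitvecs m \<Longrightarrow> wire_values gs inp ! w = \<phi> inp"
    unfolding computes_def by blast
  with gs show thesis
    by (intro that[of "Circuit gs w"])
      (auto simp: wf_circuit_def circuit_size_def circuit_value_def straight_line_def)
qed

text \<open>Each party sends the value of its literal for every test and clause. Carol spends one OR
  per clause and one AND to attach it; each test adds 2 gates for the empty conjunction and one OR
  joining it to the others.\<close>

lemma admits_BSM_protocol_or_of_ands:
  fixes \<alpha> \<beta> :: "'k \<Rightarrow> 'j \<Rightarrow> bool list \<Rightarrow> bool"
  assumes f: "\<And>x y. x \<in> bitvecs n \<Longrightarrow> y \<in> bitvecs n \<Longrightarrow>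
      f x y \<longleftrightarrow> (\<exists>t \<in> set ts. \<forall>j \<in> set js. \<alpha> t j x \<or> \<beta> t j y)"
  shows "\<exists>s \<le> length ts * (length js * 2 + 3) + 2. admits_BSM_protocol n f s"
proof -
  \<comment> \<open>The dummy entry provides an input wire, without which no constant is computable.\<close>
  define qs where "qs = (undefined, undefined) # List.product ts js"
  define N where "N = length qs"
  define A where "A x = map (\<lambda>(t, j). \<alpha> t j x) qs" for x
  define B where "B y = map (\<lambda>(t, j). \<beta> t j y) qs" for y
  \<comment> \<open>Any occurrence of the pair serves, as the bits sent depend only on the pair;
    this covers repeated entries and the dummy.\<close>
  define pos where "pos t j = (SOME i. i < N \<and> qs ! i = (t, j))" for t j
  have pos: "pos t j < N \<and> qs ! pos t j = (t, j)" if "t \<in> set ts" "j \<in> set js" for t j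
  proof -
    have "(t, j) \<in> set qs" using that by (simp add: qs_def)
    then show ?thesis
      unfolding pos_def N_def by (rule someI_ex[OF in_set_conv_nth[THEN iffD1]])
  qed
  define \<phi> where "\<phi> inp \<longleftrightarrow> (\<exists>t \<in> set ts. \<forall>j \<in> set js. inp ! pos t j \<or> inp ! (N + pos t j))"
    for inp :: "bool list"
  have N: "0 < N + N" by (simp add: N_def qs_def)
  have "extension_cost (N + N) (length ts * ((length js * (1 + 1) + 2) + 1) + 2) \<phi>"
    unfolding \<phi>_def
  proof (intro extension_cost_Bex extension_cost_Ball N)
    fix t j assume "t \<in> set ts" "j \<in> set js"
    then show "extension_cost (N + N) 1 (\<lambda>inp. inp ! pos t j \<or> inp ! (N + pos t j))"
      using extension_cost_Or[OF extension_cost_input extension_cost_input,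
          of "pos t j" "N + N" "N + pos t j"] pos by fastforce
  qed
  moreover have "length ts * ((length js * (1 + 1) + 2) + 1) + 2 = length ts * (length js * 2 + 3) + 2"
    by (simp add: algebra_simps)
  ultimately have "extension_cost (N + N) (length ts * (length js * 2 + 3) + 2) \<phi>"
    by (simp only:)
  then obtain C where C: "wf_circuit (N + N) C" "circuit_size C \<le> length ts * (length js * 2 + 3) + 2"
      "\<And>inp. inp \<in> bitvecs (N + N) \<Longrightarrow> circuit_value C inp = \<phi> inp"
    using extension_cost_imp_circuit by blast
  have "is_BSM_protocol n f N N A B C"
    unfolding is_BSM_protocol_def
  proof (intro conjI ballI)
    show "A \<in> bitvecs n \<rightarrow> bitvecs N" "B \<in> bitvecs n \<rightarrow> bitvecs N"
      by (simp_all add: A_def B_def N_def bitvecs_def)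
    show "wf_circuit (N + N) C" by (rule C)
  next
    fix x y assume xy: "x \<in> bitvecs n" "y \<in> bitvecs n"
    have len: "length (A x) = N" "length (B y) = N"
      by (simp_all add: A_def B_def N_def)
    have "circuit_value C (A x @ B y) = \<phi> (A x @ B y)"
      using len by (intro C) (simp add: bitvecs_def)
    also have "\<dots> \<longleftrightarrow> (\<exists>t \<in> set ts. \<forall>j \<in> set js. \<alpha> t j x \<or> \<beta> t j y)"
      unfolding \<phi>_def
    proof (intro bex_cong ball_cong refl)
      fix t j assume "t \<in> set ts" "j \<in> set js"
      then show "((A x @ B y) ! pos t j \<or> (A x @ B y) ! (N + pos t j)) = (\<alpha> t j x \<or> \<beta> t j y)"
        using pos[of t j] len by (simp add: nth_append A_def B_def N_def)
    qed
    finally show "f x y = circuit_value C (A x @ B y)"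
      using f[OF xy] by simp
  qed
  then show ?thesis
    using C(2) unfolding admits_BSM_protocol_def by blast
qed

section \<open>Vectors above a given one\<close>

definition weight :: "bool list \<Rightarrow> nat" where
  "weight x = length (filter id x)"

definition vectors_above :: "bool list \<Rightarrow> bool list set" where
  "vectors_above x = {z. list_all2 (\<le>) x z}"

lemma weight_Cons: "weight (b # x) = (if b then Suc (weight x) else weight x)"
  by (simp add: weight_def)

lemma vectors_above_Nil [simp]: "vectors_above [] = {[]}"
  by (auto simp: vectors_above_def)

lemma vectors_above_Cons:
  "vectors_above (b # x) =
     (if b then {} else Cons False ` vectors_above x) \<union> Cons True ` vectors_above x"
  by (auto simp: vectors_above_def list_all2_Cons1)

lemma finite_vectors_above [simp]: "finite (vectors_above x)"
  by (induction x) (auto simp: vectors_above_Cons)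

text \<open>The ratios \<open>8/5\<close> and \<open>13/8\<close> of Fibonacci numbers approximate the golden ratio.\<close>

lemma sum_weight_above_le:
  "(\<Sum>z \<in> vectors_above x. (5/8 :: real) ^ weight z) \<le> (5/8) ^ (2 * weight x) * (13/8) ^ length x"
proof (induction x)
  case Nil
  then show ?case by (simp add: weight_def)
next
  case (Cons b x)
  let ?S = "\<Sum>z \<in> vectors_above x. (5/8 :: real) ^ weight z"
  have T: "(\<Sum>z \<in> Cons True ` vectors_above x. (5/8 :: real) ^ weight z) = 5/8 * ?S"
    by (simp add: sum.reindex weight_Cons sum_distrib_left sum_divide_distrib)
  have F: "(\<Sum>z \<in> Cons False ` vectors_above x. (5/8 :: real) ^ weight z) = ?S"
    by (simp add: sum.reindex weight_Cons)
  show ?case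
  proof (cases b)
    case True
    have "(\<Sum>z \<in> vectors_above (b # x). (5/8 :: real) ^ weight z) = 5/8 * ?S"
      using True T by (simp add: vectors_above_Cons)
    also have "\<dots> \<le> 5/8 * ((5/8) ^ (2 * weight x) * (13/8) ^ length x)"
      using Cons.IH by simp
    \<comment> \<open>A one of \<open>x\<close> is forced in \<open>z\<close> and contributes
      \<open>q = 5/8\<close>, while the bound gains \<open>q^2 * (1 + q)\<close>; this suffices as
      \<open>q^2 + q = 65/64 \<ge> 1\<close>.\<close>
    also have "\<dots> \<le> (25/64 * 13/8) * ((5/8) ^ (2 * weight x) * (13/8) ^ length x)"
      by (intro mult_right_mono) auto
    finally show ?thesis
      using True by (simp add: weight_Cons mult_ac)
  next
    case False
    have "(\<Sum>z \<in> vectors_above (b # x). (5/8 :: real) ^ weight z) = ?S + 5/8 * ?S"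
      using False T F by (simp add: vectors_above_Cons, subst sum.union_disjoint) auto
    then show ?thesis
      using False Cons.IH by (simp add: weight_Cons)
  qed
qed

text \<open>Markov-style: every counted \<open>z\<close> contributes at least
  \<open>(5/8) ^ (2 * weight x)\<close> to the weighted sum, and this factor cancels.\<close>

lemma card_above_weight_le:
  "real (card {z \<in> vectors_above x. weight z \<le> 2 * weight x}) \<le> (13/8) ^ length x"
proof -
  let ?W = "{z \<in> vectors_above x. weight z \<le> 2 * weight x}"
  have "real (card ?W) * (5/8) ^ (2 * weight x) = (\<Sum>z \<in> ?W. (5/8) ^ (2 * weight x))"
    by simp
  also have "\<dots> \<le> (\<Sum>z \<in> ?W. (5/8) ^ weight z)"
    by (intro sum_mono power_decreasing) auto
  also have "\<dots> \<le> (\<Sum>z \<in> vectors_above x. (5/8) ^ weight z)"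
    by (intro sum_mono2) auto
  also have "\<dots> \<le> (5/8) ^ (2 * weight x) * (13/8) ^ length x"
    by (rule sum_weight_above_le)
  finally show ?thesis by (simp add: mult.commute)
qed

section \<open>Bitwise OR, order and weight\<close>

lemma length_bitwise_or [simp]: "length (x \<or>\<^sub>b y) = min (length x) (length y)"
  by (simp add: bitwise_or_def)

lemma nth_bitwise_or [simp]:
  "i < length x \<Longrightarrow> i < length y \<Longrightarrow> (x \<or>\<^sub>b y) ! i \<longleftrightarrow> x ! i \<or> y ! i"
  by (simp add: bitwise_or_def)

lemma bitwise_or_commute: "x \<or>\<^sub>b y = y \<or>\<^sub>b x"
  by (rule nth_equalityI) auto

lemma bitwise_or_mem_vectors_above: "length x = length y \<Longrightarrow> x \<or>\<^sub>b y \<in> vectors_above x"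
  by (simp add: vectors_above_def list_all2_conv_all_nth)

lemma weight_bitwise_or_le:
  "length x = length y \<Longrightarrow> weight (x \<or>\<^sub>b y) \<le> weight x + weight y"
  by (induction x y rule: list_induct2) (auto simp: bitwise_or_def weight_def)

section \<open>The protocol\<close>

text \<open>The condition \<open>g z\<close> is settled here by the parties, so that Carol never has
  to evaluate \<open>g\<close>.\<close>

definition candidates :: "(bool list \<Rightarrow> bool) \<Rightarrow> bool list \<Rightarrow> bool list set" where
  "candidates g x = {z \<in> vectors_above x. weight z \<le> 2 * weight x \<and> g z}"

definition candidate_list :: "(bool list \<Rightarrow> bool) \<Rightarrow> bool list \<Rightarrow> bool list list" where
  "candidate_list g x = (SOME zs. distinct zs \<and> set zs = candidates g x)"

lemma candidate_list:
  "distinct (candidate_list g x)" "set (candidate_list g x) = candidates g x"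
proof -
  have "finite (candidates g x)" by (simp add: candidates_def)
  then have "\<exists>zs. distinct zs \<and> set zs = candidates g x"
    using finite_distinct_list by blast
  from someI_ex[OF this]
  show "distinct (candidate_list g x)" "set (candidate_list g x) = candidates g x"
    by (simp_all add: candidate_list_def)
qed

text \<open>The bound depends on \<open>x\<close> only through its length, so the number of tests
  can be the same for all inputs.\<close>

lemma length_candidate_list: "length (candidate_list g x) \<le> nat \<lfloor>(13/8 :: real) ^ length x\<rfloor>"
proof -
  have "length (candidate_list g x) = card (candidates g x)"
    using candidate_list[of g x] by (metis distinct_card)
  also have "\<dots> \<le> card {z \<in> vectors_above x. weight z \<le> 2 * weight x}"
    by (intro card_mono) (auto simp: candidates_def)
  finally have "real (length (candidate_list g x)) \<le> (13/8) ^ length x"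
    using card_above_weight_le[of x] by linarith
  then show ?thesis by (rule le_nat_floor)
qed

text \<open>The test number \<open>t\<close> of the party holding \<open>x\<close> is a conjunction of clauses, to each of which
  either party contributes a literal. Clause \<open>Some (i, b)\<close> says that \<open>y ! i = b\<close> if \<open>b\<close> is the
  \<open>i\<close>-th bit of the candidate and \<open>x ! i\<close> is \<open>False\<close>; clause \<open>None\<close> makes a test without a candidate
  fail.\<close>

fun claim :: "(bool list \<Rightarrow> bool) \<Rightarrow> nat \<Rightarrow> (nat \<times> bool) option \<Rightarrow> bool list \<Rightarrow> bool" where
  "claim g t None x \<longleftrightarrow> t < length (candidate_list g x)"
| "claim g t (Some (i, b)) x \<longleftrightarrow> x ! i \<or> candidate_list g x ! t ! i \<noteq> b"

fun reply :: "(nat \<times> bool) option \<Rightarrow> bool list \<Rightarrow> bool" where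
  "reply None y \<longleftrightarrow> False"
| "reply (Some (i, b)) y \<longleftrightarrow> y ! i = b"

definition clauses :: "nat \<Rightarrow> (nat \<times> bool) option list" where
  "clauses n = None # map Some (List.product [0..<n] [True, False])"

lemma length_clauses: "length (clauses n) = 2 * n + 1"
  by (simp add: clauses_def)

text \<open>Where \<open>x ! i\<close> holds, \<open>z ! i\<close> holds too, so only the zeros of
  \<open>x\<close> constrain \<open>y\<close>: the condition is a subcube.\<close>

lemma bitwise_or_eq_iff:
  assumes "z \<in> vectors_above x" "length x = n" "length y = n"
  shows "x \<or>\<^sub>b y = z \<longleftrightarrow> (\<forall>i < n. x ! i \<or> y ! i = z ! i)"
  using assms by (auto simp: vectors_above_def list_all2_conv_all_nth list_eq_iff_nth_eq)

text \<open>Only the party holding \<open>x\<close> knows the candidate \<open>z\<close>, so the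
  equation \<open>y ! i = z ! i\<close> is split into one clause for each value \<open>b\<close>;
  the clause with the wrong \<open>b\<close> is satisfied by \<open>claim\<close> alone.\<close>

lemma test_succeeds_iff:
  assumes "length x = n" "length y = n"
  shows "(\<exists>t < nat \<lfloor>(13/8 :: real) ^ n\<rfloor>. \<forall>j \<in> set (clauses n). claim g t j x \<or> reply j y) \<longleftrightarrow>
    x \<or>\<^sub>b y \<in> candidates g x"
proof -
  let ?K = "nat \<lfloor>(13/8 :: real) ^ n\<rfloor>" and ?zs = "candidate_list g x"
  have test: "(\<forall>j \<in> set (clauses n). claim g t j x \<or> reply j y) \<longleftrightarrow>
      t < length ?zs \<and> x \<or>\<^sub>b y = ?zs ! t" for t
  proof (cases "t < length ?zs")
    case True
    then have "?zs ! t \<in> candidates g x"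
      using candidate_list(2) nth_mem by blast
    then have "x \<or>\<^sub>b y = ?zs ! t \<longleftrightarrow> (\<forall>i < n. x ! i \<or> y ! i = ?zs ! t ! i)"
      using assms by (intro bitwise_or_eq_iff) (auto simp: candidates_def)
    then show ?thesis
      using True by (auto simp: clauses_def)
  next
    case False
    then show ?thesis by (simp add: clauses_def)
  qed
  have "(\<exists>t < ?K. t < length ?zs \<and> x \<or>\<^sub>b y = ?zs ! t) \<longleftrightarrow> x \<or>\<^sub>b y \<in> set ?zs"
    using length_candidate_list[of g x] assms by (force simp: in_set_conv_nth)
  then show ?thesis
    using test candidate_list(2) by simp
qed

text \<open>Candidates satisfy \<open>g\<close>, so neither list gives a wrong yes. Conversely, the
  OR has weight at most \<open>weight x + weight y\<close>, hence at most twice the larger one, and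
  the heavier party lists it.\<close>

lemma g_bitwise_or_iff:
  assumes "length x = length y"
  shows "g (x \<or>\<^sub>b y) \<longleftrightarrow> x \<or>\<^sub>b y \<in> candidates g x \<or> x \<or>\<^sub>b y \<in> candidates g y"
  using assms bitwise_or_mem_vectors_above[of x y] bitwise_or_mem_vectors_above[of y x]
    weight_bitwise_or_le[of x y] bitwise_or_commute[of x y]
  by (cases "weight x \<le> weight y") (auto simp: candidates_def)

lemma admits_BSM_protocol_bitwise_or:
  "\<exists>s \<le> 2 * nat \<lfloor>(13/8 :: real) ^ n\<rfloor> * (4 * n + 5) + 2.
     admits_BSM_protocol n (\<lambda>x y. g (x \<or>\<^sub>b y)) s"
proof -
  define K where "K = nat \<lfloor>(13/8 :: real) ^ n\<rfloor>"
  define ts :: "(nat + nat) list" where "ts = map Inl [0..<K] @ map Inr [0..<K]"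
  define \<alpha> where "\<alpha> t j x = (case t of Inl t \<Rightarrow> claim g t j x | Inr _ \<Rightarrow> reply j x)"
    for t :: "nat + nat" and j x
  define \<beta> where "\<beta> t j y = (case t of Inl _ \<Rightarrow> reply j y | Inr t \<Rightarrow> claim g t j y)"
    for t :: "nat + nat" and j y
  have "g (x \<or>\<^sub>b y) \<longleftrightarrow> (\<exists>t \<in> set ts. \<forall>j \<in> set (clauses n). \<alpha> t j x \<or> \<beta> t j y)"
    if "x \<in> bitvecs n" "y \<in> bitvecs n" for x y
  proof -
    have len: "length x = n" "length y = n" using that by (auto simp: bitvecs_def)
    have "(\<exists>t \<in> set ts. \<forall>j \<in> set (clauses n). \<alpha> t j x \<or> \<beta> t j y) \<longleftrightarrow>
        (\<exists>t < K. \<forall>j \<in> set (clauses n). claim g t j x \<or> reply j y) \<or>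
        (\<exists>t < K. \<forall>j \<in> set (clauses n). claim g t j y \<or> reply j x)"
      by (auto simp: ts_def \<alpha>_def \<beta>_def bex_Un disj_commute)
    also have "\<dots> \<longleftrightarrow> x \<or>\<^sub>b y \<in> candidates g x \<or> y \<or>\<^sub>b x \<in> candidates g y"
      unfolding K_def using len by (simp only: test_succeeds_iff)
    also have "\<dots> \<longleftrightarrow> g (x \<or>\<^sub>b y)"
      using g_bitwise_or_iff[of x y g] len bitwise_or_commute[of x y] by simp
    finally show ?thesis by simp
  qed
  \<comment> \<open>There are \<open>2 * K\<close> tests with \<open>2 * n + 1\<close> clauses each,
    and \<open>(2 * n + 1) * 2 + 3 = 4 * n + 5\<close>.\<close>
  from admits_BSM_protocol_or_of_ands[OF this] show ?thesis
    by (simp add: ts_def K_def[symmetric] length_clauses algebra_simps)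
qed

section \<open>Asymptotics of the size bound\<close>

lemma size_bound_bigo:
  "(\<lambda>n. real (2 * nat \<lfloor>(13/8 :: real) ^ n\<rfloor> * (4 * n + 5) + 2)) \<in> O(\<lambda>n. 2 powr (0.729 * real n))"
proof -
  \<comment> \<open>The exponent 0.72 exceeds the base-2 logarithm of 13/8, about 0.7004, and its
    gap to 0.729 absorbs the linear factor. Taking 25th powers reduces the claim to
    \<open>13 ^ 25 \<le> 2 ^ 93\<close>.\<close>
  have root: "(13/8 :: real) \<le> 2 powr 0.72"
  proof (rule power_le_imp_le_base[of _ 24])
    have "(2 powr 0.72 :: real) ^ Suc 24 = 2 ^ 18"
      by (simp add: powr_power)
    then show "(13/8 :: real) ^ Suc 24 \<le> (2 powr 0.72) ^ Suc 24"
      by (simp add: power_divide)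
  qed simp
  have "real (2 * nat \<lfloor>(13/8 :: real) ^ n\<rfloor> * (4 * n + 5) + 2)
      \<le> 2 * 2 powr (0.72 * real n) * (4 * real n + 5) + 2" for n
  proof -
    have "real (nat \<lfloor>(13/8 :: real) ^ n\<rfloor>) \<le> (13/8) ^ n"
      by (simp add: of_nat_floor)
    also have "\<dots> \<le> (2 powr 0.72) ^ n"
      by (intro power_mono root) simp
    also have "\<dots> = 2 powr (0.72 * real n)"
      by (simp add: powr_power mult.commute)
    finally show ?thesis
      by (simp add: mult_right_mono)
  qed
  then have "(\<lambda>n. real (2 * nat \<lfloor>(13/8 :: real) ^ n\<rfloor> * (4 * n + 5) + 2))
      \<in> O(\<lambda>n. 2 * 2 powr (0.72 * real n) * (4 * real n + 5) + 2)"
    by (intro landau_o.big_mono always_eventually) (simp add: abs_of_nonneg del: of_nat_add of_nat_mult)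
  also have "(\<lambda>n. 2 * 2 powr (0.72 * real n) * (4 * real n + 5) + 2)
      \<in> O(\<lambda>n. 2 powr (0.729 * real n))"
    by real_asymp
  finally show ?thesis .
qed

theorem theoremB25:
  shows "\<exists>t :: nat \<Rightarrow> nat.
    (\<lambda>n. real (t n)) \<in> O(\<lambda>n. 2 powr (0.729 * real n)) \<and>
    (\<forall>(n :: nat) (g :: bool list \<Rightarrow> bool).
       \<exists>s \<le> t n. admits_BSM_protocol n (\<lambda>x y. g (x \<or>\<^sub>b y)) s)"
  using size_bound_bigo admits_BSM_protocol_bitwise_or
  by (intro exI[of _ "\<lambda>n. 2 * nat \<lfloor>(13/8 :: real) ^ n\<rfloor> * (4 * n + 5) + 2"] conjI allI)

end
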